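(* Let $V$ be a finite set, let $Z_1,\ldots,Z_m$ be independent random variables, and let a subset $W_i\subseteq V$ be given for each $i=1,\ldots,m$. For every $v\in V$ let $X_v$ be a random variable taking finitely many values that is a measurable function of those $Z_i$ for which $v\in W_i$. Then for any set $E$ of hyperedges over $V$ (i.e. any collection $E$ of subsets of $V$), $$\sum_{e\in E}H(X_e)\ \ge\ \beta\sum_{v\in V}H(X_v),\qquad\text{where}\quad \beta=\min_{1\le i\le m;\ W\subseteq W_i}\frac{|\overline{W}|}{|W|}.$$
   Context: For $U\subseteq V$, $X_U=(X_v)_{v\in U}$ and $H(X_U)$ is the joint Shannon entropy, i.e. the entropy $\sum_j -p_j\log p_j$ of the joint distribution of $(X_v)_{v\in U}$. For $W\subseteq V$, $\overline{W}=\{e\in E:\ e\cap W\ne\emptyset\}$. The minimum is over all pairs $(i,W)$ with $W$ a nonempty subset of $W_i$; at least one $W_i$ is nonempty so that such pairs exist. *)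

theory Defs
  imports "HOL-Probability.Probability"
begin

text \<open>Shannon entropy, to base b, of a random variable with finitely many values: the library
  entropy with respect to the counting measure on the range, i.e. the library's notation
  H(X) made available outside its locale.\<close>

definition shannon_entropy :: "real \<Rightarrow> 'a measure \<Rightarrow> ('a \<Rightarrow> 'b) \<Rightarrow> real" where
  "shannon_entropy b M X = prob_space.entropy M b (count_space (X ` space M)) X"

lemma (in information_space) shannon_entropy_eq_sum:
  assumes "simple_function M X"
  shows "shannon_entropy b M X =
    (\<Sum>x\<in>X ` space M. - prob (X -` {x} \<inter> space M) * log b (prob (X -` {x} \<inter> space M)))"
  unfolding shannon_entropy_def
  using entropy_simple_distributed[OF simple_distributedI[OF assms measure_nonneg refl]]
  by (simp add: sum_negf)

text \<open>For an empty index set the joint variable is constant, so its entropy is zero.\<close>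

definition joint :: "('v \<Rightarrow> 'a \<Rightarrow> 'c) \<Rightarrow> 'v set \<Rightarrow> 'a \<Rightarrow> 'v \<Rightarrow> 'c" where
  "joint X U = (\<lambda>\<omega>. \<lambda>v\<in>U. X v \<omega>)"

text \<open>With J empty, the product space is a single point and Y is constant.\<close>

definition measurable_function_of ::
  "'a measure \<Rightarrow> 'i set \<Rightarrow> ('i \<Rightarrow> 'z measure) \<Rightarrow> ('i \<Rightarrow> 'a \<Rightarrow> 'z) \<Rightarrow> 'c measure \<Rightarrow> ('a \<Rightarrow> 'c) \<Rightarrow> bool" where
  "measurable_function_of M J N Z S Y \<longleftrightarrow>
     (\<exists>f \<in> measurable (PiM J N) S. \<forall>\<omega>\<in>space M. Y \<omega> = f (\<lambda>j\<in>J. Z j \<omega>))"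

definition touching :: "'v set set \<Rightarrow> 'v set \<Rightarrow> 'v set set" where
  "touching E U = {e \<in> E. e \<inter> U \<noteq> {}}"

definition cover_ratio :: "nat \<Rightarrow> (nat \<Rightarrow> 'v set) \<Rightarrow> 'v set set \<Rightarrow> real" where
  "cover_ratio m W E =
     Min {real (card (touching E U)) / real (card U) | i U. i \<in> {1..m} \<and> U \<subseteq> W i \<and> U \<noteq> {}}"

end

theory Submission
  imports Defs
begin

text \<open>
  The independent variables are revealed one at a time. Revealing \<open>Z i\<close> lowers the (conditional)
  entropy of \<open>X\<^sub>e\<close> by an amount \<open>G i e\<close>, the information that \<open>Z i\<close> gives about \<open>X\<^sub>e\<close>; since nothing is
  left uncertain at the end, \<open>H(X\<^sub>e) = (\<Sum>i. G i e)\<close>, and likewise \<open>H(X\<^sub>v) = (\<Sum>i. g i v)\<close>. It therefore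
  suffices to compare \<open>\<Sum>e. G i e\<close> with \<open>\<beta> * (\<Sum>v. g i v)\<close> for each \<open>i\<close> separately. Two facts hold for
  fixed \<open>i\<close>: information does not grow under functions, so \<open>g i v \<le> G i e\<close> whenever \<open>v \<in> e\<close>
  (\<open>mutual_info_data_processing\<close>); and \<open>g i v = 0\<close> for \<open>v \<notin> W i\<close>, because such an \<open>X\<^sub>v\<close> does not depend on
  \<open>Z i\<close>. Hence every level set \<open>U = {v. g i v > t}\<close> lies in \<open>W i\<close>, at least \<open>\<beta> * card U\<close> edges touch it,
  and on each of these \<open>G i\<close> exceeds \<open>t\<close>; integrating over \<open>t\<close> gives the comparison
  (\<open>layer_cake_cover\<close>).

  The variables \<open>Z i\<close> are arbitrary, so conditioning on them is made concrete by moving to the product of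
  their laws, where conditioning on one coordinate means fixing it. The steps of the revelation become
  an induction on the number of coordinates (\<open>product_space_entropy_cover\<close>): by
  \<open>entropy_chain_rule\<close>, the entropy is the information given by the new coordinate plus the average
  entropy of the slices, and the induction hypothesis applies to every slice. All the laws that
  occur then have finite support and depend measurably on a single parameter, the value of the new
  coordinate, and conditioning is undone by integrating over this parameter.
\<close>

section \<open>Entropy of a finite variable and its mixtures\<close>

definition entropy_term :: "real \<Rightarrow> real" where
  "entropy_term t = - t * ln t"

text \<open>The mass function of the distribution of \<open>Y\<close>; unlike an image measure it does not refer to a
  sigma-algebra on the range.\<close>

definition law :: "'a measure \<Rightarrow> ('a \<Rightarrow> 'b) \<Rightarrow> 'b \<Rightarrow> real" where
  "law P Y y = measure P (Y -` {y} \<inter> space P)"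

text \<open>The sum runs over a given set \<open>S\<close> containing the values of \<open>Y\<close>, not over the range of \<open>Y\<close>, so that
  \<open>S\<close> stays the same for all slices of \<open>Y\<close>. Natural logarithms avoid carrying the base along.\<close>

definition entropy_nats :: "'a measure \<Rightarrow> 'b set \<Rightarrow> ('a \<Rightarrow> 'b) \<Rightarrow> real" where
  "entropy_nats P S Y = (\<Sum>y\<in>S. entropy_term (law P Y y))"

text \<open>If a parameter \<open>a\<close> is drawn from \<open>K\<close> and then a value \<open>y\<close> with probability \<open>p a y\<close>, this is the
  mutual information of the value and the parameter: the entropy of the value minus its conditional
  entropy given the parameter.\<close>

definition mutual_info :: "'a measure \<Rightarrow> 'b set \<Rightarrow> ('a \<Rightarrow> 'b \<Rightarrow> real) \<Rightarrow> real" where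
  "mutual_info K S p = (\<Sum>y\<in>S. entropy_term (\<integral>a. p a y \<partial>K) - (\<integral>a. entropy_term (p a y) \<partial>K))"

lemma borel_measurable_entropy_term [measurable]: "entropy_term \<in> borel_measurable borel"
  unfolding entropy_term_def by measurable

lemma entropy_term_0 [simp]: "entropy_term 0 = 0" and entropy_term_1 [simp]: "entropy_term 1 = 0"
  by (simp_all add: entropy_term_def)

lemma entropy_term_bounds:
  assumes "0 \<le> t" "t \<le> 1"
  shows "0 \<le> entropy_term t" "entropy_term t \<le> 1"
proof -
  show "0 \<le> entropy_term t"
    using assms by (cases "t = 0") (auto simp: entropy_term_def mult_nonneg_nonpos ln_le_zero_iff)
  show "entropy_term t \<le> 1"
  proof (cases "t = 0")
    case False
    with assms have "t > 0" by simp
    have "- ln t \<le> 1 / t - 1"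
      using ln_le_minus_one[of "1 / t"] \<open>t > 0\<close> by (simp add: ln_div)
    then have "t * (- ln t) \<le> t * (1 / t - 1)"
      using \<open>t > 0\<close> by (intro mult_left_mono) auto
    also have "\<dots> = 1 - t"
      using \<open>t > 0\<close> by (simp add: algebra_simps)
    finally show ?thesis
      using \<open>t > 0\<close> by (simp add: entropy_term_def)
  qed simp
qed

text \<open>The function \<open>(p, q) \<mapsto> p * ln (p / q)\<close> is convex and homogeneous, so it lies above its tangent plane at
  \<open>(P, Q)\<close>. Because \<open>P\<close> and \<open>Q\<close> will be the means of \<open>p\<close> and \<open>q\<close>, the linear correction
  \<open>p - q * P / Q\<close> integrates to zero.\<close>

lemma log_sum_tangent:
  fixes p q P Q :: real
  assumes "0 \<le> p" "p \<le> q" "0 < P" "P \<le> Q"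
  shows "p * (ln P - ln Q) + (p - q * P / Q) \<le> p * (ln p - ln q)"
proof (cases "p = 0")
  case True
  then show ?thesis using assms by (auto simp: field_simps)
next
  case False
  with assms have pos: "p > 0" "q > 0" "Q > 0" by auto
  have "ln (q * P / (p * Q)) \<le> q * P / (p * Q) - 1"
    using pos assms by (intro ln_le_minus_one) auto
  moreover have "ln (q * P / (p * Q)) = ln q + ln P - ln p - ln Q"
    using pos assms by (simp add: ln_div ln_mult)
  ultimately have "p * (ln q + ln P - ln p - ln Q) \<le> p * (q * P / (p * Q) - 1)"
    using pos by (intro mult_left_mono) auto
  also have "\<dots> = q * P / Q - p"
    using pos by (simp add: field_simps)
  finally show ?thesis by (simp add: algebra_simps)
qed

lemma (in prob_space) integrable_unit_interval:
  assumes [measurable]: "p \<in> borel_measurable M"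
    and "\<And>a. a \<in> space M \<Longrightarrow> 0 \<le> p a \<and> p a \<le> (1::real)"
  shows "integrable M p" "integrable M (\<lambda>a. entropy_term (p a))"
    "0 \<le> (\<integral>a. p a \<partial>M)"
proof -
  show int: "integrable M p"
    by (rule integrable_const_bound[where B = 1]) (use assms in auto)
  have "norm (entropy_term (p a)) \<le> 1" if "a \<in> space M" for a
    using entropy_term_bounds[of "p a"] assms(2)[OF that] by auto
  then show "integrable M (\<lambda>a. entropy_term (p a))"
    by (intro integrable_const_bound[where B = 1]) auto
  show "0 \<le> (\<integral>a. p a \<partial>M)"
    using assms(2) by (intro integral_nonneg_AE) auto
qed

text \<open>Jensen's inequality for \<open>(p, q) \<mapsto> p * ln (p / q)\<close>, the integral form of the log-sum inequality.
  The right-hand side is the integral of \<open>p * ln (p / q)\<close>, split in this way because the two parts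
  are summed separately later.\<close>

lemma (in prob_space) averaged_log_sum:
  fixes p q :: "'a \<Rightarrow> real"
  assumes [measurable]: "p \<in> borel_measurable M" "q \<in> borel_measurable M"
    and pq: "\<And>a. a \<in> space M \<Longrightarrow> 0 \<le> p a \<and> p a \<le> q a \<and> q a \<le> 1"
  defines "P \<equiv> \<integral>a. p a \<partial>M" and "Q \<equiv> \<integral>a. q a \<partial>M"
  shows "integrable M (\<lambda>a. p a * ln (q a))"
    and "P * (ln P - ln Q) \<le> - (\<integral>a. entropy_term (p a) \<partial>M) - (\<integral>a. p a * ln (q a) \<partial>M)"
proof -
  have p01: "0 \<le> p a \<and> p a \<le> 1" and q01: "0 \<le> q a \<and> q a \<le> 1" if "a \<in> space M" for a
    using pq[OF that] by auto
  note intp = integrable_unit_interval[of p, OF _ p01, simplified]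
  note intq = integrable_unit_interval[of q, OF _ q01, simplified]
  show int: "integrable M (\<lambda>a. p a * ln (q a))"
  proof (rule Bochner_Integration.integrable_bound[OF intq(2)])
    have "norm (p a * ln (q a)) \<le> norm (entropy_term (q a))" if "a \<in> space M" for a
      using pq[OF that] by (auto simp: entropy_term_def abs_mult intro!: mult_right_mono)
    then show "AE a in M. norm (p a * ln (q a)) \<le> norm (entropy_term (q a))"
      by auto
  qed simp
  have split: "- (\<integral>a. entropy_term (p a) \<partial>M) - (\<integral>a. p a * ln (q a) \<partial>M)
    = (\<integral>a. p a * (ln (p a) - ln (q a)) \<partial>M)"
    using intp(2) int
    by (simp flip: Bochner_Integration.integral_minus Bochner_Integration.integral_diff
        add: entropy_term_def right_diff_distrib)
  show "P * (ln P - ln Q) \<le> - (\<integral>a. entropy_term (p a) \<partial>M) - (\<integral>a. p a * ln (q a) \<partial>M)"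
  proof (cases "P = 0")
    case True
    have "AE a in M. p a = 0"
      using True integral_nonneg_eq_0_iff_AE[OF intp(1)] p01 unfolding P_def by auto
    then have "(\<integral>a. p a * (ln (p a) - ln (q a)) \<partial>M) = (\<integral>a. 0 \<partial>M)"
      by (intro integral_cong_AE) auto
    then show ?thesis unfolding split using True by simp
  next
    case False
    then have "P > 0" using intp(3) unfolding P_def by simp
    have "P \<le> Q"
      unfolding P_def Q_def using pq intp intq by (intro integral_mono) auto
    have "P * (ln P - ln Q) = (\<integral>a. p a * (ln P - ln Q) + (p a - q a * P / Q) \<partial>M)"
    proof -
      have "(\<integral>a. p a * (ln P - ln Q) + (p a - q a * P / Q) \<partial>M)
        = P * (ln P - ln Q) + (P - Q * P / Q)"
        unfolding P_def Q_def using intp intq by simp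
      then show ?thesis using \<open>P > 0\<close> \<open>P \<le> Q\<close> by simp
    qed
    also have "\<dots> \<le> (\<integral>a. p a * (ln (p a) - ln (q a)) \<partial>M)"
    proof (rule integral_mono)
      show "integrable M (\<lambda>a. p a * (ln P - ln Q) + (p a - q a * P / Q))"
        using intp intq by simp
      have "integrable M (\<lambda>a. - entropy_term (p a) - p a * ln (q a))"
        using intp(2) int by simp
      then show "integrable M (\<lambda>a. p a * (ln (p a) - ln (q a)))"
        by (simp add: entropy_term_def right_diff_distrib)
    qed (use pq \<open>P > 0\<close> \<open>P \<le> Q\<close> in \<open>auto intro!: log_sum_tangent\<close>)
    finally show ?thesis unfolding split .
  qed
qed

text \<open>Let \<open>q\<close> be the image of \<open>p\<close> under \<open>h\<close>. The difference of the two sides is the mutual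
  information of the value and the parameter conditional on the image of the value. By
  \<open>averaged_log_sum\<close>, applied to the mass at \<open>x\<close> inside the mass of the fibre of \<open>h x\<close>, each value
  \<open>x\<close> contributes a nonnegative term to it.\<close>

lemma (in prob_space) mutual_info_data_processing:
  fixes p :: "'a \<Rightarrow> 'b \<Rightarrow> real" and h :: "'b \<Rightarrow> 'c"
  assumes fin: "finite S" "finite T" and h: "h ` S \<subseteq> T"
    and meas: "\<And>x. x \<in> S \<Longrightarrow> (\<lambda>a. p a x) \<in> borel_measurable M"
    and nonneg: "\<And>a x. a \<in> space M \<Longrightarrow> x \<in> S \<Longrightarrow> 0 \<le> p a x"
    and total: "\<And>a. a \<in> space M \<Longrightarrow> (\<Sum>x\<in>S. p a x) = 1"
    and q: "\<And>a y. a \<in> space M \<Longrightarrow> y \<in> T \<Longrightarrow> q a y = (\<Sum>x | x \<in> S \<and> h x = y. p a x)"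
  shows "mutual_info M T q \<le> mutual_info M S p"
proof -
  (* q is prescribed on T and on the space only; r is the same kernel, defined everywhere. *)
  define r where "r a y = (\<Sum>x | x \<in> S \<and> h x = y. p a x)" for a y
  have r_meas: "(\<lambda>a. r a y) \<in> borel_measurable M" for y
    unfolding r_def using meas by (intro borel_measurable_sum) auto
  have r01: "0 \<le> r a y \<and> r a y \<le> 1" if "a \<in> space M" for a y
  proof
    show "0 \<le> r a y" unfolding r_def using nonneg[OF that] by (intro sum_nonneg) auto
    have "r a y \<le> (\<Sum>x\<in>S. p a x)"
      unfolding r_def using nonneg[OF that] fin by (intro sum_mono2) auto
    then show "r a y \<le> 1" using total[OF that] by simp
  qed
  have pr: "0 \<le> p a x \<and> p a x \<le> r a (h x) \<and> r a (h x) \<le> 1" if "a \<in> space M" "x \<in> S" for a x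
    using nonneg[OF that(1)] r01[OF that(1)] that fin
    by (auto simp: r_def intro!: member_le_sum[where f = "p a" and i = x])
  have p01: "0 \<le> p a x \<and> p a x \<le> 1" if "a \<in> space M" "x \<in> S" for a x
    using pr[OF that] by linarith
  define P where "P x = (\<integral>a. p a x \<partial>M)" for x
  define R where "R y = (\<integral>a. r a y \<partial>M)" for y
  have R_sum: "R y = (\<Sum>x | x \<in> S \<and> h x = y. P x)" for y
    unfolding R_def P_def r_def
    using integrable_unit_interval(1)[OF meas p01] by (intro Bochner_Integration.integral_sum) auto
  have term_le: "- (\<integral>a. p a x * ln (r a (h x)) \<partial>M) + P x * ln (R (h x))
      \<ge> (\<integral>a. entropy_term (p a x) \<partial>M) - entropy_term (P x)" if "x \<in> S" for x
    using averaged_log_sum(2)[of "\<lambda>a. p a x" "\<lambda>a. r a (h x)", OF meas[OF that] r_meas pr[OF _ that]]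
    unfolding P_def R_def entropy_term_def by (simp add: algebra_simps)
  have fiber: "(\<Sum>x | x \<in> S \<and> h x = y. - (\<integral>a. p a x * ln (r a (h x)) \<partial>M) + P x * ln (R (h x)))
      = (\<integral>a. entropy_term (r a y) \<partial>M) - entropy_term (R y)" for y
  proof -
    have "(\<integral>a. entropy_term (r a y) \<partial>M) = (\<integral>a. (\<Sum>x | x \<in> S \<and> h x = y. - (p a x * ln (r a y))) \<partial>M)"
      by (simp add: entropy_term_def sum_negf r_def[of _ y] flip: sum_distrib_right)
    also have "\<dots> = (\<Sum>x | x \<in> S \<and> h x = y. - (\<integral>a. p a x * ln (r a y) \<partial>M))"
      using averaged_log_sum(1)[OF meas r_meas pr]
      by (subst Bochner_Integration.integral_sum) auto
    finally have "(\<integral>a. entropy_term (r a y) \<partial>M) = (\<Sum>x | x \<in> S \<and> h x = y. - (\<integral>a. p a x * ln (r a y) \<partial>M))" .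
    moreover have "entropy_term (R y) = - (\<Sum>x | x \<in> S \<and> h x = y. P x * ln (R y))"
      unfolding entropy_term_def by (subst (1) R_sum) (simp add: sum_distrib_right)
    ultimately show ?thesis
      by (simp add: sum_subtractf sum_negf)
  qed
  have "mutual_info M T q = mutual_info M T r"
    unfolding mutual_info_def r_def using q
    by (intro sum.cong refl arg_cong2[where f = "(-)"] arg_cong[where f = entropy_term]
        Bochner_Integration.integral_cong) auto
  also have "mutual_info M T r = - (\<Sum>y\<in>T. (\<integral>a. entropy_term (r a y) \<partial>M) - entropy_term (R y))"
    by (simp add: mutual_info_def R_def sum_subtractf)
  also have "\<dots> = - (\<Sum>x\<in>S. - (\<integral>a. p a x * ln (r a (h x)) \<partial>M) + P x * ln (R (h x)))"
    unfolding fiber[symmetric] by (subst sum.group[OF fin h]) rule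
  also have "\<dots> \<le> - (\<Sum>x\<in>S. (\<integral>a. entropy_term (p a x) \<partial>M) - entropy_term (P x))"
    using term_le by (simp add: sum_mono)
  also have "\<dots> = mutual_info M S p"
    by (simp add: mutual_info_def P_def sum_subtractf)
  finally show ?thesis .
qed

text \<open>Data processing for the map to a one-point set.\<close>

lemma (in prob_space) mutual_info_nonneg:
  assumes "finite S" "\<And>x. x \<in> S \<Longrightarrow> (\<lambda>a. p a x) \<in> borel_measurable M"
    and "\<And>a x. a \<in> space M \<Longrightarrow> x \<in> S \<Longrightarrow> 0 \<le> p a x"
    and "\<And>a. a \<in> space M \<Longrightarrow> (\<Sum>x\<in>S. p a x) = 1"
  shows "0 \<le> mutual_info M S p"
proof -
  have "mutual_info M {()} (\<lambda>_ _. 1) \<le> mutual_info M S p"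
    by (rule mutual_info_data_processing[where h = "\<lambda>_. ()"]) (use assms in auto)
  then show ?thesis by (simp add: mutual_info_def prob_space)
qed

lemma (in prob_space) mutual_info_constant:
  assumes "\<And>a y. a \<in> space M \<Longrightarrow> p a y = c y"
  shows "mutual_info M S p = 0"
proof -
  have "(\<integral>a. p a y \<partial>M) = (\<integral>a. c y \<partial>M)" "(\<integral>a. entropy_term (p a y) \<partial>M) = (\<integral>a. entropy_term (c y) \<partial>M)" for y
    by (intro Bochner_Integration.integral_cong refl; simp add: assms)+
  then show ?thesis by (simp add: mutual_info_def prob_space)
qed

section \<open>Laws of functions of finite variables\<close>

lemma (in prob_space) law_bounds: "0 \<le> law M Y y" "law M Y y \<le> 1"
  by (simp_all add: law_def)

lemma (in prob_space) law_comp: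
  assumes "finite S" and Y: "Y \<in> measurable M (count_space S)"
  shows "law M (\<lambda>\<omega>. h (Y \<omega>)) y = (\<Sum>x | x \<in> S \<and> h x = y. law M Y x)"
proof -
  have "(\<lambda>\<omega>. h (Y \<omega>)) -` {y} \<inter> space M = (\<Union>x\<in>{x\<in>S. h x = y}. Y -` {x} \<inter> space M)"
    using measurable_space[OF Y] by auto
  moreover have "Y -` {x} \<inter> space M \<in> events" if "x \<in> S" for x
    using that by (intro measurable_sets[OF Y]) simp
  ultimately show ?thesis
    unfolding law_def using \<open>finite S\<close>
    by (subst finite_measure_finite_Union[symmetric])
      (auto simp: disjoint_family_on_def simp del: UN_simps)
qed

lemma (in prob_space) law_total:
  assumes "finite S" and Y: "Y \<in> measurable M (count_space S)"
  shows "(\<Sum>x\<in>S. law M Y x) = 1"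
  using law_comp[OF assms, of "\<lambda>_. ()" "()"] by (simp add: law_def prob_space)

lemma entropy_nats_singleton_space:
  assumes "prob_space P" "space P = {\<omega>}"
  shows "entropy_nats P S Y = 0"
proof -
  interpret prob_space P by fact
  have "Y -` {y} \<inter> space P = {} \<or> Y -` {y} \<inter> space P = space P" for y
    using assms(2) by auto
  then have "law P Y y \<in> {0, 1}" for y
    unfolding law_def using prob_space by (metis insert_iff measure_empty)
  then have "entropy_term (law P Y y) = 0" for y
    using entropy_term_0 entropy_term_1 by (metis insertE empty_iff)
  then show ?thesis by (simp add: entropy_nats_def)
qed

section \<open>A layer-cake inequality for covers\<close>

text \<open>The integral over the levels \<open>t\<close> is replaced by an induction on the size of the support \<open>U\<close> of
  \<open>g\<close>. With \<open>c\<close> the least positive value of \<open>g\<close>, subtract \<open>c\<close> from \<open>g\<close> on \<open>U\<close> and from \<open>G\<close> on the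
  edges touching \<open>U\<close>. The hypotheses survive, the support shrinks, and the amounts removed from
  the two sides satisfy the inequality by \<open>cover\<close>.\<close>

lemma layer_cake_cover:
  fixes g :: "'v \<Rightarrow> real" and G :: "'v set \<Rightarrow> real" and \<beta> :: real
  assumes fin: "finite V" "finite E"
    and g: "\<And>v. v \<in> V \<Longrightarrow> 0 \<le> g v" and supp: "{v\<in>V. 0 < g v} \<subseteq> W"
    and G: "\<And>e. e \<in> E \<Longrightarrow> 0 \<le> G e" "\<And>e v. e \<in> E \<Longrightarrow> v \<in> e \<Longrightarrow> v \<in> V \<Longrightarrow> g v \<le> G e"
    and cover: "\<And>U. U \<subseteq> W \<Longrightarrow> U \<noteq> {} \<Longrightarrow> \<beta> * card U \<le> card (touching E U)"
  shows "\<beta> * (\<Sum>v\<in>V. g v) \<le> (\<Sum>e\<in>E. G e)"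
  using g supp G
proof (induction "card {v\<in>V. 0 < g v}" arbitrary: g G rule: less_induct)
  case less
  define U where "U = {v\<in>V. 0 < g v}"
  have finU: "finite U" using fin by (simp add: U_def)
  show ?case
  proof (cases "U = {}")
    case True
    then have "g v = 0" if "v \<in> V" for v
      using less.prems(1)[OF that] that unfolding U_def by force
    then show ?thesis using less.prems(3) by (simp add: sum_nonneg)
  next
    case False
    define c where "c = Min (g ` U)"
    have c_in: "c \<in> g ` U" unfolding c_def using False finU by (intro Min_in) auto
    then have "c > 0" by (auto simp: U_def)
    have c_le: "c \<le> g v" if "v \<in> U" for v
      unfolding c_def using that finU by auto
    define g' where "g' v = g v - (if v \<in> U then c else 0)" for v
    define G' where "G' e = G e - (if e \<inter> U \<noteq> {} then c else 0)" for e
    have g_out: "g v = 0" if "v \<in> V" "v \<notin> U" for v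
      using less.prems(1)[OF that(1)] that unfolding U_def by force
    have U_V: "U \<subseteq> V" by (auto simp: U_def)
    have sub: "{v\<in>V. 0 < g' v} \<subset> U"
    proof
      show "{v\<in>V. 0 < g' v} \<subseteq> U" using g_out by (auto simp: g'_def) (metis less_irrefl)
      obtain u where "u \<in> U" "g u = c" using c_in by auto
      then show "{v\<in>V. 0 < g' v} \<noteq> U" by (auto simp: g'_def)
    qed
    have "\<beta> * (\<Sum>v\<in>V. g' v) \<le> (\<Sum>e\<in>E. G' e)"
    proof (rule less.hyps)
      show "card {v\<in>V. 0 < g' v} < card {v\<in>V. 0 < g v}"
        using psubset_card_mono[OF finU sub] by (simp add: U_def)
      show "0 \<le> g' v" if "v \<in> V" for v
        using c_le less.prems(1)[OF that] by (auto simp: g'_def)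
      show "{v\<in>V. 0 < g' v} \<subseteq> W" using sub less.prems(2) by (auto simp: U_def)
      show G'_pos: "0 \<le> G' e" if "e \<in> E" for e
      proof (cases "e \<inter> U = {}")
        case False
        then obtain u where "u \<in> e" "u \<in> U" by auto
        then have "c \<le> G e"
          using c_le less.prems(4)[OF that] U_V by (meson order_trans subsetD)
        then show ?thesis using False by (simp add: G'_def)
      qed (use less.prems(3)[OF that] in \<open>simp add: G'_def\<close>)
      show "g' v \<le> G' e" if "e \<in> E" "v \<in> e" "v \<in> V" for e v
      proof (cases "v \<in> U")
        case True
        then show ?thesis using less.prems(4)[OF that] that by (auto simp: g'_def G'_def)
      next
        case False
        then show ?thesis using G'_pos[OF that(1)] g_out that by (simp add: g'_def)
      qed
    qed
    moreover have "(\<Sum>v\<in>V. g' v) = (\<Sum>v\<in>V. g v) - c * card U"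
      unfolding g'_def using fin(1) U_V
      by (simp add: sum_subtractf sum.If_cases Int_absorb1)
    moreover have "(\<Sum>e\<in>E. G' e) = (\<Sum>e\<in>E. G e) - c * card (touching E U)"
      unfolding G'_def using fin(2)
      by (simp add: sum_subtractf sum.If_cases touching_def Int_def)
    moreover have "c * (\<beta> * card U) \<le> c * card (touching E U)"
      using cover[OF _ False] less.prems(2) \<open>c > 0\<close> by (intro mult_left_mono) (auto simp: U_def)
    ultimately show ?thesis by (simp add: algebra_simps)
  qed
qed

section \<open>Induction over the independent coordinates\<close>

lemma slice_measurable:
  assumes Y: "Y \<in> measurable (PiM (insert i I) N) L" and a: "a \<in> space (N i)"
  shows "(\<lambda>z. Y (z(i := a))) \<in> measurable (PiM I N) L"
proof -
  have "(\<lambda>z. (\<lambda>(f, y). f(i := y)) (z, a)) \<in> measurable (PiM I N) (PiM (insert i I) N)"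
    using measurable_compose[OF measurable_Pair2'[of a "N i", OF a] measurable_add_dim[of i I N]] .
  then show ?thesis
    using measurable_compose[OF _ Y] by simp
qed

text \<open>Fubini for the indicator of the event that \<open>Y\<close> takes the value \<open>y\<close>.\<close>

lemma law_slice:
  fixes N :: "'i \<Rightarrow> 'z measure"
  assumes N: "\<And>j. prob_space (N j)" and I: "finite I" "i \<notin> I" and "y \<in> S"
    and Y: "Y \<in> measurable (PiM (insert i I) N) (count_space S)"
  shows "(\<lambda>a. law (PiM I N) (\<lambda>z. Y (z(i := a))) y) \<in> borel_measurable (N i)" (is "?p \<in> _")
    and "law (PiM (insert i I) N) Y y = (\<integral>a. law (PiM I N) (\<lambda>z. Y (z(i := a))) y \<partial>N i)"
proof -
  interpret N: product_sigma_finite N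
    by (intro product_sigma_finite.intro) (metis N prob_space_imp_sigma_finite)
  interpret PI: prob_space "PiM I N" by (intro prob_space_PiM N)
  interpret PiI: prob_space "PiM (insert i I) N" by (intro prob_space_PiM N)
  interpret Ni: prob_space "N i" by (rule N)
  define B where "B = Y -` {y} \<inter> space (PiM (insert i I) N)"
  have B [measurable]: "B \<in> sets (PiM (insert i I) N)"
    unfolding B_def by (intro measurable_sets[OF Y]) (use \<open>y \<in> S\<close> in simp)
  have slice: "emeasure (PiM I N) ((\<lambda>z. Y (z(i := a))) -` {y} \<inter> space (PiM I N))
      = (\<integral>\<^sup>+z. indicator B (z(i := a)) \<partial>PiM I N)" if a: "a \<in> space (N i)" for a
  proof -
    have "(\<lambda>z. Y (z(i := a))) -` {y} \<inter> space (PiM I N) \<in> sets (PiM I N)"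
      by (intro measurable_sets[OF slice_measurable[OF Y a]]) (use \<open>y \<in> S\<close> in simp)
    then have "emeasure (PiM I N) ((\<lambda>z. Y (z(i := a))) -` {y} \<inter> space (PiM I N))
      = (\<integral>\<^sup>+z. indicator ((\<lambda>z. Y (z(i := a))) -` {y} \<inter> space (PiM I N)) z \<partial>PiM I N)"
      by simp
    also have "\<dots> = (\<integral>\<^sup>+z. indicator B (z(i := a)) \<partial>PiM I N)"
      using a by (intro nn_integral_cong)
        (auto simp: B_def indicator_def space_PiM PiE_insert_eq)
    finally show ?thesis .
  qed
  have joint: "(\<lambda>(a, z). indicator B (z(i := a)) :: ennreal) \<in> borel_measurable (N i \<Otimes>\<^sub>M PiM I N)"
  proof -
    have "(\<lambda>z. (\<lambda>(f, y). f(i := y)) (snd z, fst z)) \<in> measurable (N i \<Otimes>\<^sub>M PiM I N) (PiM (insert i I) N)"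
      by (rule measurable_compose[OF _ measurable_add_dim]) simp
    then have "(\<lambda>z. indicator B ((\<lambda>(f, y). f(i := y)) (snd z, fst z)) :: ennreal)
        \<in> borel_measurable (N i \<Otimes>\<^sub>M PiM I N)"
      by (rule measurable_compose) simp
    then show ?thesis by (simp add: case_prod_beta')
  qed
  have "(\<lambda>a. \<integral>\<^sup>+z. indicator B (z(i := a)) \<partial>PiM I N) \<in> borel_measurable (N i)"
    using PI.borel_measurable_nn_integral[OF joint] by simp
  then have "(\<lambda>a. enn2real (\<integral>\<^sup>+z. indicator B (z(i := a)) \<partial>PiM I N)) \<in> borel_measurable (N i)"
    by simp
  then show meas: "?p \<in> borel_measurable (N i)"
    by (rule measurable_cong[THEN iffD1, rotated]) (simp add: law_def measure_def slice)
  have "ennreal (law (PiM (insert i I) N) Y y) = emeasure (PiM (insert i I) N) B"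
    by (simp add: law_def B_def PiI.emeasure_eq_measure)
  also have "\<dots> = (\<integral>\<^sup>+x. indicator B x \<partial>PiM (insert i I) N)"
    by simp
  also have "\<dots> = (\<integral>\<^sup>+a. \<integral>\<^sup>+z. indicator B (z(i := a)) \<partial>PiM I N \<partial>N i)"
    by (rule N.product_nn_integral_insert_rev[OF I]) simp
  also have "\<dots> = (\<integral>\<^sup>+a. ennreal (?p a) \<partial>N i)"
    by (intro nn_integral_cong) (simp add: law_def slice flip: PI.emeasure_eq_measure)
  also have "\<dots> = ennreal (\<integral>a. ?p a \<partial>N i)"
    by (intro nn_integral_eq_integral Ni.integrable_unit_interval(1)[OF meas])
      (auto simp: PI.law_bounds)
  finally show "law (PiM (insert i I) N) Y y = (\<integral>a. ?p a \<partial>N i)"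
    using PiI.law_bounds by (subst (asm) ennreal_inj) (auto intro!: Bochner_Integration.integral_nonneg PI.law_bounds)
qed

text \<open>The law of \<open>Y\<close> is the mixture of the laws of its slices, so the entropy of \<open>Y\<close> exceeds the average
  entropy of the slices by the information that the coordinate \<open>i\<close> gives about \<open>Y\<close>.\<close>

lemma entropy_chain_rule:
  fixes N :: "'i \<Rightarrow> 'z measure"
  assumes N: "\<And>j. prob_space (N j)" and I: "finite I" "i \<notin> I"
    and Y: "Y \<in> measurable (PiM (insert i I) N) (count_space S)"
  shows "entropy_nats (PiM (insert i I) N) S Y =
      mutual_info (N i) S (\<lambda>a. law (PiM I N) (\<lambda>z. Y (z(i := a))))
      + (\<integral>a. entropy_nats (PiM I N) S (\<lambda>z. Y (z(i := a))) \<partial>N i)" (is ?chain)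
    and "integrable (N i) (\<lambda>a. entropy_nats (PiM I N) S (\<lambda>z. Y (z(i := a))))" (is ?int)
proof -
  interpret PI: prob_space "PiM I N" by (intro prob_space_PiM N)
  interpret Ni: prob_space "N i" by (rule N)
  have int: "integrable (N i) (\<lambda>a. entropy_term (law (PiM I N) (\<lambda>z. Y (z(i := a))) y))" if "y \<in> S" for y
    using law_slice(1)[OF N I that Y]
    by (intro Ni.integrable_unit_interval(2)) (auto simp: PI.law_bounds)
  show ?int
    unfolding entropy_nats_def using int by (intro Bochner_Integration.integrable_sum) auto
  have "(\<integral>a. entropy_nats (PiM I N) S (\<lambda>z. Y (z(i := a))) \<partial>N i)
      = (\<Sum>y\<in>S. \<integral>a. entropy_term (law (PiM I N) (\<lambda>z. Y (z(i := a))) y) \<partial>N i)"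
    unfolding entropy_nats_def using int by (intro Bochner_Integration.integral_sum) auto
  then show ?chain
    using law_slice(2)[OF N I _ Y] by (simp add: entropy_nats_def mutual_info_def sum_subtractf)
qed

lemma joint_measurable:
  assumes "finite e" "\<And>v. v \<in> e \<Longrightarrow> finite (A v)"
    and X: "\<And>v. v \<in> e \<Longrightarrow> X v \<in> measurable P (count_space (A v))"
  shows "joint X e \<in> measurable P (count_space (PiE e A))"
proof -
  (* count_space_PiM_finite asks for countable sets at all indices, also outside e. *)
  have "PiM e (\<lambda>v. count_space (A v)) = PiM e (\<lambda>v. count_space (if v \<in> e then A v else {}))"
    by (intro PiM_cong) auto
  also have "\<dots> = count_space (PiE e (\<lambda>v. if v \<in> e then A v else {}))"
    using assms(1,2) by (intro count_space_PiM_finite) (auto simp: countable_finite)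
  also have "PiE e (\<lambda>v. if v \<in> e then A v else {}) = PiE e A"
    by (intro PiE_cong) auto
  finally have "PiM e (\<lambda>v. count_space (A v)) = count_space (PiE e A)" .
  moreover have "joint X e \<in> measurable P (PiM e (\<lambda>v. count_space (A v)))"
    unfolding joint_def using X by (rule measurable_restrict)
  ultimately show ?thesis by simp
qed

text \<open>That \<open>f v\<close> is a function of the coordinates \<open>i\<close> with \<open>v \<in> W i\<close> only is expressed by invariance
  under changing any single other coordinate, a form that passes directly to the slices.\<close>

lemma product_space_entropy_cover:
  fixes N :: "'i \<Rightarrow> 'z measure" and f :: "'v \<Rightarrow> ('i \<Rightarrow> 'z) \<Rightarrow> 'c" and \<beta> :: real
  assumes N: "\<And>j. prob_space (N j)" and V: "finite V" "\<And>v. v \<in> V \<Longrightarrow> finite (A v)"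
    and E: "E \<subseteq> Pow V" and "finite I"
    and f: "\<And>v. v \<in> V \<Longrightarrow> f v \<in> measurable (PiM I N) (count_space (A v))"
    and indep: "\<And>v i z a. v \<in> V \<Longrightarrow> i \<in> I \<Longrightarrow> v \<notin> W i \<Longrightarrow> z \<in> space (PiM I N) \<Longrightarrow>
        a \<in> space (N i) \<Longrightarrow> f v (z(i := a)) = f v z"
    and cover: "\<And>i U. i \<in> I \<Longrightarrow> U \<subseteq> W i \<Longrightarrow> U \<noteq> {} \<Longrightarrow> \<beta> * card U \<le> card (touching E U)"
  shows "\<beta> * (\<Sum>v\<in>V. entropy_nats (PiM I N) (A v) (f v))
    \<le> (\<Sum>e\<in>E. entropy_nats (PiM I N) (PiE e A) (joint f e))"
  using \<open>finite I\<close> f indep cover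
proof (induction I arbitrary: f rule: finite_induct)
  case empty
  (* The product over no coordinates is a point, so both sides vanish. *)
  have "prob_space (PiM {} N)" by (intro prob_space_PiM N)
  note trivial = entropy_nats_singleton_space[OF this space_PiM_empty]
  show ?case unfolding trivial by simp
next
  case (insert i I)
  interpret PI: prob_space "PiM I N" by (intro prob_space_PiM N)
  interpret Ni: prob_space "N i" by (rule N)
  let ?P = "PiM (insert i I) N"
  define s where "s a v z = f v (z(i := a))" for a v z
  have dep: "f v (z(j := a)) = f v z"
    if "v \<in> V" "j \<in> insert i I" "v \<notin> W j" "z \<in> space ?P" "a \<in> space (N j)" for v j z a
    using insert.prems(2)[OF that] .
  have finE: "finite E" using E V(1) by (meson finite_Pow_iff finite_subset)
  have e: "finite e" "e \<subseteq> V" if "e \<in> E" for e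
    using that E V(1) finite_subset by blast+
  have s: "s a v \<in> measurable (PiM I N) (count_space (A v))" if "a \<in> space (N i)" "v \<in> V" for a v
    unfolding s_def using slice_measurable[OF insert.prems(1)] that by blast
  have joint_f: "joint f e \<in> measurable ?P (count_space (PiE e A))" if "e \<in> E" for e
    using e[OF that] V insert.prems(1) by (intro joint_measurable) auto
  have joint_s: "joint (s a) e \<in> measurable (PiM I N) (count_space (PiE e A))"
    if "a \<in> space (N i)" "e \<in> E" for a e
    using e[OF that(2)] V s[OF that(1)] by (intro joint_measurable) auto
  have finPiE: "finite (PiE e A)" if "e \<in> E" for e
    using e[OF that] V by (intro finite_PiE) auto
  have s_joint: "(\<lambda>z. joint f e (z(i := a))) = joint (s a) e" for e a
    by (simp add: joint_def s_def fun_eq_iff)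
  (* The information that the coordinate i gives about f v and about joint f e. *)
  define g where "g v = mutual_info (N i) (A v) (\<lambda>a. law (PiM I N) (s a v))" for v
  define G where "G e = mutual_info (N i) (PiE e A) (\<lambda>a. law (PiM I N) (joint (s a) e))" for e
  note chain_v = entropy_chain_rule[OF N insert.hyps insert.prems(1), folded s_def, folded g_def]
  note chain_e = entropy_chain_rule[OF N insert.hyps joint_f, unfolded s_joint, folded G_def]
  note meas_v = law_slice(1)[OF N insert.hyps _ insert.prems(1), folded s_def]
  note meas_e = law_slice(1)[OF N insert.hyps _ joint_f, unfolded s_joint]
  have "\<beta> * (\<Sum>v\<in>V. g v) \<le> (\<Sum>e\<in>E. G e)"
  proof (rule layer_cake_cover[OF V(1) finE])
    show "0 \<le> g v" if "v \<in> V" for v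
      unfolding g_def
      by (intro Ni.mutual_info_nonneg V(2) meas_v PI.law_bounds PI.law_total[OF _ s] that)
    show "0 \<le> G e" if "e \<in> E" for e
      unfolding G_def
      by (intro Ni.mutual_info_nonneg finPiE meas_e PI.law_bounds PI.law_total[OF _ joint_s] that)
    show "g v \<le> G e" if "e \<in> E" "v \<in> e" "v \<in> V" for e v
      unfolding g_def G_def
    proof (rule Ni.mutual_info_data_processing[where h = "\<lambda>x. x v"])
      show "law (PiM I N) (s a v) y
          = (\<Sum>x | x \<in> PiE e A \<and> x v = y. law (PiM I N) (joint (s a) e) x)"
        if "a \<in> space (N i)" for a y
        using PI.law_comp[OF finPiE joint_s, of e a "\<lambda>x. x v" y] \<open>e \<in> E\<close> \<open>v \<in> e\<close> that
        by (simp add: joint_def)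
      show "finite (A v)" using V(2) that by simp
      show "(\<lambda>x. x v) ` PiE e A \<subseteq> A v" using that by auto
    qed (intro finPiE meas_e PI.law_bounds PI.law_total[OF _ joint_s] that; assumption)+
    show "{v \<in> V. 0 < g v} \<subseteq> W i"
    proof (rule ccontr)
      assume "\<not> {v \<in> V. 0 < g v} \<subseteq> W i"
      then obtain v where v: "v \<in> V" "v \<notin> W i" "0 < g v" by auto
      obtain a0 where a0: "a0 \<in> space (N i)" using Ni.not_empty by auto
      have "s a v z = s a0 v z" if "a \<in> space (N i)" "z \<in> space (PiM I N)" for a z
      proof -
        have "z(i := a0) \<in> space ?P"
          using that(2) a0 by (auto simp: space_PiM PiE_insert_eq)
        then have "f v (z(i := a0, i := a)) = f v (z(i := a0))"
          using v that(1) by (intro dep) auto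
        then show ?thesis by (simp only: s_def fun_upd_upd)
      qed
      then have "law (PiM I N) (s a v) = law (PiM I N) (s a0 v)" if "a \<in> space (N i)" for a
        using that unfolding law_def
        by (intro ext arg_cong[where f = "measure (PiM I N)"]) auto
      then have "g v = 0"
        unfolding g_def by (intro Ni.mutual_info_constant[where c = "law (PiM I N) (s a0 v)"]) simp
      then show False using v by simp
    qed
    show "\<beta> * card U \<le> card (touching E U)" if "U \<subseteq> W i" "U \<noteq> {}" for U
      by (rule insert.prems(3)) (use that in auto)
  qed
  moreover have "\<beta> * (\<Sum>v\<in>V. \<integral>a. entropy_nats (PiM I N) (A v) (s a v) \<partial>N i)
      \<le> (\<Sum>e\<in>E. \<integral>a. entropy_nats (PiM I N) (PiE e A) (joint (s a) e) \<partial>N i)"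
  proof -
    have "\<beta> * (\<Sum>v\<in>V. \<integral>a. entropy_nats (PiM I N) (A v) (s a v) \<partial>N i)
        = (\<integral>a. \<beta> * (\<Sum>v\<in>V. entropy_nats (PiM I N) (A v) (s a v)) \<partial>N i)"
      using chain_v(2) by (simp add: Bochner_Integration.integral_sum)
    also have "\<dots> \<le> (\<integral>a. (\<Sum>e\<in>E. entropy_nats (PiM I N) (PiE e A) (joint (s a) e)) \<partial>N i)"
    proof (rule integral_mono)
      fix a assume a: "a \<in> space (N i)"
      show "\<beta> * (\<Sum>v\<in>V. entropy_nats (PiM I N) (A v) (s a v))
          \<le> (\<Sum>e\<in>E. entropy_nats (PiM I N) (PiE e A) (joint (s a) e))"
      proof (rule insert.IH)
        show "s a v (z(j := c)) = s a v z"
          if "v \<in> V" "j \<in> I" "v \<notin> W j" "z \<in> space (PiM I N)" "c \<in> space (N j)" for v j z c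
        proof -
          have "j \<noteq> i" using insert.hyps that by auto
          moreover have "z(i := a) \<in> space (PiM (insert i I) N)"
            using that(4) a by (auto simp: space_PiM PiE_insert_eq)
          ultimately show ?thesis
            unfolding s_def using dep[of v j "z(i := a)" c] that
            by (simp add: fun_upd_twist)
        qed
      qed (use s[OF a] insert.prems(3) in auto)
    qed (use chain_v(2) chain_e(2) in auto)
    also have "\<dots> = (\<Sum>e\<in>E. \<integral>a. entropy_nats (PiM I N) (PiE e A) (joint (s a) e) \<partial>N i)"
      using chain_e(2) by (simp add: Bochner_Integration.integral_sum)
    finally show ?thesis .
  qed
  ultimately show ?case
    using chain_v(1) chain_e(1) by (simp add: sum.distrib distrib_left)
qed

section \<open>Transfer to the given probability space\<close>

text \<open>Elements of \<open>S\<close> outside the range of \<open>Y\<close> have mass zero and add nothing, since \<open>0 * ln 0 = 0\<close>.\<close>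

lemma (in information_space) shannon_entropy_eq_entropy_nats:
  assumes "finite S" and Y: "Y \<in> measurable M (count_space S)"
  shows "shannon_entropy b M Y = entropy_nats M S Y / ln b"
proof -
  have range: "Y ` space M \<subseteq> S" using measurable_space[OF Y] by auto
  have "simple_function M Y"
    unfolding simple_function_def
  proof (intro conjI ballI)
    show "finite (Y ` space M)" using range assms(1) by (rule finite_subset)
    show "Y -` {y} \<inter> space M \<in> events" if "y \<in> Y ` space M" for y
      using that range by (intro measurable_sets[OF Y]) auto
  qed
  then have "shannon_entropy b M Y = (\<Sum>y\<in>Y ` space M. entropy_term (law M Y y)) / ln b"
    by (simp add: shannon_entropy_eq_sum entropy_term_def law_def log_def sum_divide_distrib)
  also have "(\<Sum>y\<in>Y ` space M. entropy_term (law M Y y)) = entropy_nats M S Y"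
    unfolding entropy_nats_def
  proof (rule sum.mono_neutral_left[OF assms(1) range], rule ballI)
    fix y assume "y \<in> S - Y ` space M"
    then have "Y -` {y} \<inter> space M = {}" by auto
    then show "entropy_term (law M Y y) = 0" by (simp add: law_def)
  qed
  finally show ?thesis .
qed

lemma entropy_nats_distr:
  assumes T: "T \<in> measurable M P" and Y: "Y \<in> measurable P (count_space S)"
  shows "entropy_nats (distr M P T) S Y = entropy_nats M S (\<lambda>\<omega>. Y (T \<omega>))"
proof -
  have "law (distr M P T) Y y = law M (\<lambda>\<omega>. Y (T \<omega>)) y" if "y \<in> S" for y
  proof -
    have "Y -` {y} \<inter> space P \<in> sets P" by (intro measurable_sets[OF Y]) (use that in simp)
    then show ?thesis
      using measurable_space[OF T] by (auto simp: law_def measure_distr[OF T] intro!: arg_cong[where f = "measure M"])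
  qed
  then show ?thesis by (simp add: entropy_nats_def)
qed

theorem theorem2p4:
  fixes M :: "'a measure" and b :: real
    and V :: "'v set" and E :: "'v set set"
    and m :: nat and W :: "nat \<Rightarrow> 'v set"
    and N :: "nat \<Rightarrow> 'z measure" and Z :: "nat \<Rightarrow> 'a \<Rightarrow> 'z"
    and A :: "'v \<Rightarrow> 'c set" and X :: "'v \<Rightarrow> 'a \<Rightarrow> 'c"
  assumes "prob_space M" and "b > 1"
    and "finite V"
    and "prob_space.indep_vars M N Z {1..m}"
    and "\<And>i. i \<in> {1..m} \<Longrightarrow> W i \<subseteq> V"
    and "\<exists>i\<in>{1..m}. W i \<noteq> {}"
    and "\<And>v. v \<in> V \<Longrightarrow> finite (A v)"
    and "\<And>v. v \<in> V \<Longrightarrow>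
           measurable_function_of M {i \<in> {1..m}. v \<in> W i} N Z (count_space (A v)) (X v)"
    and "E \<subseteq> Pow V"
  shows "(\<Sum>e\<in>E. shannon_entropy b M (joint X e))
           \<ge> cover_ratio m W E * (\<Sum>v\<in>V. shannon_entropy b M (X v))"
proof -
  interpret information_space M b
    using assms(1,2) by (simp add: information_space_def information_space_axioms_def)
  define I where "I = {1..m}"
  define J where "J v = {i\<in>I. v \<in> W i}" for v
  define \<beta> where "\<beta> = cover_ratio m W E"
  obtain k where k: "k \<in> I" using assms(6) unfolding I_def by blast
  have Z: "Z i \<in> measurable M (N i)" if "i \<in> I" for i
    using assms(4) that by (auto simp: indep_vars_def I_def)
  (* The lemma on product spaces asks for a probability measure at every index, also outside I. *)
  define D where "D i = (if i \<in> I then distr M (N i) (Z i) else distr M (N k) (Z k))" for i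
  have D: "prob_space (D i)" for i
    unfolding D_def using Z k by (auto intro: prob_space_distr)
  have sets_D: "sets (D i) = sets (N i)" if "i \<in> I" for i
    using that by (simp add: D_def)
  define T where "T \<omega> = (\<lambda>i\<in>I. Z i \<omega>)" for \<omega>
  have T: "T \<in> measurable M (PiM I N)"
    unfolding T_def by (intro measurable_restrict Z)
  have "distr M (PiM I N) T = PiM I (\<lambda>i. distr M (N i) (Z i))"
    unfolding T_def
  proof (rule indep_vars_iff_distr_eq_PiM'[THEN iffD1])
    show "indep_vars N Z I" using assms(4) by (simp only: I_def)
  qed (use k Z in auto)
  also have "\<dots> = PiM I D"
    by (intro PiM_cong) (auto simp: D_def)
  finally have distr_T: "distr M (PiM I N) T = PiM I D" .
  have "\<exists>h. h \<in> measurable (PiM (J v) N) (count_space (A v)) \<and>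
      (\<forall>\<omega>\<in>space M. X v \<omega> = h (\<lambda>j\<in>J v. Z j \<omega>))" if "v \<in> V" for v
    using assms(8)[OF that] by (auto simp: measurable_function_of_def J_def I_def)
  then obtain h where h: "\<And>v. v \<in> V \<Longrightarrow> h v \<in> measurable (PiM (J v) N) (count_space (A v))"
    and X_h: "\<And>v \<omega>. v \<in> V \<Longrightarrow> \<omega> \<in> space M \<Longrightarrow> X v \<omega> = h v (\<lambda>j\<in>J v. Z j \<omega>)"
    by metis
  define f where "f v z = h v (restrict z (J v))" for v z
  have f: "f v \<in> measurable (PiM I N) (count_space (A v))" if "v \<in> V" for v
    unfolding f_def
    by (rule measurable_compose[OF measurable_restrict_subset h[OF that]]) (auto simp: J_def)
  have X_f: "X v \<omega> = f v (T \<omega>)" if "v \<in> V" "\<omega> \<in> space M" for v \<omega>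
  proof -
    have "restrict (T \<omega>) (J v) = (\<lambda>j\<in>J v. Z j \<omega>)" by (auto simp: T_def J_def fun_eq_iff)
    then show ?thesis using X_h[OF that] by (simp add: f_def)
  qed
  have entropy: "shannon_entropy b M Y = entropy_nats (PiM I D) S Y' / ln b"
    if "finite S" "Y' \<in> measurable (PiM I N) (count_space S)"
      "\<And>\<omega>. \<omega> \<in> space M \<Longrightarrow> Y \<omega> = Y' (T \<omega>)" for S and Y :: "'a \<Rightarrow> 'd" and Y'
  proof -
    have comp: "(\<lambda>\<omega>. Y' (T \<omega>)) \<in> measurable M (count_space S)"
      using measurable_compose[OF T that(2)] .
    then have Y: "Y \<in> measurable M (count_space S)"
      using measurable_cong[of M Y "\<lambda>\<omega>. Y' (T \<omega>)"] that(3) by blast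
    have "law M Y = law M (\<lambda>\<omega>. Y' (T \<omega>))"
      unfolding law_def using that(3) by (intro ext arg_cong[where f = "measure M"]) auto
    then show ?thesis
      using shannon_entropy_eq_entropy_nats[OF that(1) Y] entropy_nats_distr[OF T that(2)]
      by (simp add: distr_T entropy_nats_def)
  qed
  have cover: "\<beta> * card U \<le> card (touching E U)" if "i \<in> I" "U \<subseteq> W i" "U \<noteq> {}" for i U
  proof -
    let ?R = "{real (card (touching E U)) / real (card U) | i U. i \<in> {1..m} \<and> U \<subseteq> W i \<and> U \<noteq> {}}"
    have "?R \<subseteq> (\<lambda>U. real (card (touching E U)) / real (card U)) ` Pow V"
      using assms(5) by fastforce
    then have "finite ?R" using \<open>finite V\<close> by (meson finite_Pow_iff finite_imageI finite_subset)
    then have "\<beta> \<le> card (touching E U) / card U"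
      unfolding \<beta>_def cover_ratio_def using that by (intro Min_le) (auto simp: I_def)
    moreover have "card U > 0"
      using that assms(5)[of i] finite_subset[OF _ \<open>finite V\<close>]
      by (simp add: I_def card_gt_0_iff)
    ultimately show ?thesis by (simp add: field_simps)
  qed
  have "\<beta> * (\<Sum>v\<in>V. entropy_nats (PiM I D) (A v) (f v)) \<le> (\<Sum>e\<in>E. entropy_nats (PiM I D) (PiE e A) (joint f e))"
  proof (rule product_space_entropy_cover[where W = W, OF D \<open>finite V\<close> assms(7,9)])
    show "f v \<in> measurable (PiM I D) (count_space (A v))" if "v \<in> V" for v
    proof -
      have "sets (PiM I D) = sets (PiM I N)" by (intro sets_PiM_cong refl sets_D)
      from measurable_cong_sets[OF this refl] show ?thesis using f[OF that] by (rule equalityD2[THEN subsetD])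
    qed
    show "f v (z(i := a)) = f v z" if "v \<notin> W i" for v i z a
      unfolding f_def using that by (intro arg_cong[where f = "h v"]) (auto simp: J_def fun_eq_iff)
    show "finite I" by (simp add: I_def)
  qed (assumption | erule (2) cover)+
  then have "\<beta> * (\<Sum>v\<in>V. entropy_nats (PiM I D) (A v) (f v)) / ln b
      \<le> (\<Sum>e\<in>E. entropy_nats (PiM I D) (PiE e A) (joint f e)) / ln b"
    using \<open>b > 1\<close> by (intro divide_right_mono) auto
  moreover have "(\<Sum>v\<in>V. shannon_entropy b M (X v)) = (\<Sum>v\<in>V. entropy_nats (PiM I D) (A v) (f v)) / ln b"
    unfolding sum_divide_distrib using entropy[OF assms(7) f X_f] by (intro sum.cong) auto
  moreover have "(\<Sum>e\<in>E. shannon_entropy b M (joint X e))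
      = (\<Sum>e\<in>E. entropy_nats (PiM I D) (PiE e A) (joint f e)) / ln b"
    unfolding sum_divide_distrib
  proof (intro sum.cong refl entropy)
    fix e assume "e \<in> E"
    then have e: "e \<subseteq> V" "finite e" using assms(9) \<open>finite V\<close> finite_subset by blast+
    show "finite (PiE e A)" using e assms(7) by (intro finite_PiE) auto
    show "joint f e \<in> measurable (PiM I N) (count_space (PiE e A))"
      using e f assms(7) by (intro joint_measurable) auto
    show "joint X e \<omega> = joint f e (T \<omega>)" if "\<omega> \<in> space M" for \<omega>
      using X_f e that by (auto simp: joint_def fun_eq_iff)
  qed
  ultimately show ?thesis
    by (simp add: \<beta>_def)
qed

end
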